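(* For any integer $n\ge2$, $$\sum_{k=-\infty}^{\infty}\frac{1}{(4k+1)^n}=\frac{\pi^n\,\mathrm{vol}(C_n)}{2^n},$$ where $C_n$ is the cycle on $n$ vertices.
   Context: For a graph $G=(VG,EG)$, the graph polytope is $P(G)=\{x\in[0,1]^{VG} : x_i+x_j\le 1 \text{ for every edge } ij\in EG\}$, and $\mathrm{vol}(G)$ denotes the $|VG|$-dimensional volume (Lebesgue measure) of $P(G)$. $C_n$ has vertex set $\{1,\dots,n\}$ and edges $i(i+1)$ for $1\le i\le n$, with $n+1:=1$ (so $C_2$ is a single edge); thus $\mathrm{vol}(C_n)$ is the volume of $\{x\in[0,1]^n : x_i+x_{i+1}\le1,\ 1\le i\le n\}$ with $x_{n+1}:=x_1$. The sum runs over all integers $k$ and is absolutely convergent. *)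

theory Defs
  imports "HOL-Analysis.Analysis" "Graph_Theory.Pair_Digraph"
begin

text \<open>
  Simple graphs are, as in the Graph\_Theory library, digraphs whose arc set is symmetric and
  loop-free (locale \<^locale>\<open>pair_graph\<close>): an edge \<open>ij\<close> is the pair of arcs \<open>(i, j)\<close>, \<open>(j, i)\<close>.
  Points of \<open>\<real>\<^sup>V\<close> are the functions that are \<^const>\<open>undefined\<close> outside \<open>V\<close>, so that the polytope is a
  subset of the space of the product measure on \<open>V\<close>.
\<close>

definition graph_polytope :: "'a pair_pre_digraph \<Rightarrow> ('a \<Rightarrow> real) set" where
  "graph_polytope G =
     {x \<in> pverts G \<rightarrow>\<^sub>E {0..1}. \<forall>(i, j) \<in> parcs G. x i + x j \<le> 1}"

definition graph_vol :: "'a pair_pre_digraph \<Rightarrow> real" where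
  "graph_vol G = measure (Pi\<^sub>M (pverts G) (\<lambda>_. lborel)) (graph_polytope G)"

definition cycle_succ :: "nat \<Rightarrow> nat \<Rightarrow> nat" where
  "cycle_succ n i = (if i = n then 1 else i + 1)"

text \<open>For \<open>n = 2\<close> this is a single edge.\<close>

definition cycle_graph :: "nat \<Rightarrow> nat pair_pre_digraph" where
  "cycle_graph n =
     \<lparr>pverts = {1..n},
      parcs = (\<Union>i\<in>{1..n}. {(i, cycle_succ n i), (cycle_succ n i, i)})\<rparr>"

lemma pair_graph_cycle_graph:
  assumes "n \<ge> 2"
  shows "pair_graph (cycle_graph n)"
proof
  show "symmetric (with_proj (cycle_graph n))"
    by (auto simp: cycle_graph_def symmetric_def arcs_ends_def arc_to_ends_def sym_def)
qed (use assms in \<open>auto simp: cycle_graph_def cycle_succ_def split: if_splits\<close>)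

lemma graph_polytope_cycle_graph:
  "graph_polytope (cycle_graph n) =
    {x \<in> {1..n} \<rightarrow>\<^sub>E {0..1}. \<forall>i\<in>{1..n}. x i + x (if i = n then 1 else i + 1) \<le> 1}"
  by (auto simp: graph_polytope_def cycle_graph_def cycle_succ_def add.commute)

lemma graph_polytope_measurable:
  assumes "pair_fin_digraph G"
  shows "graph_polytope G \<in> sets (Pi\<^sub>M (pverts G) (\<lambda>_. lborel))"
proof -
  interpret pair_fin_digraph G by fact
  let ?M = "Pi\<^sub>M (pverts G) (\<lambda>_. lborel :: real measure)"
  have "graph_polytope G = {x \<in> space ?M. (\<forall>i\<in>pverts G. 0 \<le> x i \<and> x i \<le> 1) \<and>
      (\<forall>e\<in>parcs G. x (fst e) + x (snd e) \<le> 1)}"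
    by (fastforce simp: graph_polytope_def space_PiM PiE_iff)
  also have "\<dots> \<in> sets ?M"
  proof -
    have comp [measurable]: "(\<lambda>x. x i) \<in> borel_measurable ?M" if "i \<in> pverts G" for i
      using measurable_component_singleton[OF that, of "\<lambda>_. lborel"] by simp
    have "{x \<in> space ?M. \<forall>i\<in>pverts G. 0 \<le> x i \<and> x i \<le> 1} \<in> sets ?M"
      by (intro sets.sets_Collect_finite_All[OF _ pair_finite_verts] sets.sets_Collect_conj) auto
    moreover have "{x \<in> space ?M. x (fst e) + x (snd e) \<le> 1} \<in> sets ?M" if "e \<in> parcs G" for e
    proof -
      have "fst e \<in> pverts G" "snd e \<in> pverts G"
        using that arc_fst_in_verts arc_snd_in_verts by (auto simp: prod_eq_iff)
      then show ?thesis by measurable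
    qed
    ultimately show ?thesis
      by (intro sets.sets_Collect_conj sets.sets_Collect_finite_All[OF _ pair_finite_arcs]) auto
  qed
  finally show ?thesis .
qed

end

(* The operator (T f)(x) = integral of f over [0, 1 - x] on L^2[0,1] is self-adjoint, with
   eigenfunctions cos ((4k+1) pi x / 2) and eigenvalues 2 / ((4k+1) pi), k an integer. The volume of
   the cycle polytope is the trace of T^n. To avoid spectral theory, the eigenfunction expansion of
   the kernel of T^n is proved directly: for n = 2 the kernel is 1 - max x y and its expansion is the
   Fourier series of a triangle wave; the step from n to n + 1 is termwise integration. *)
theory Submission
  imports Defs "HOL-Real_Asymp.Real_Asymp" "HOL-Library.Nat_Bijection"
begin

section \<open>Fourier series of the square wave and the triangle wave\<close>

text \<open>Each term times \<open>2 * sin u\<close> is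
  \<open>sin (2 * (j + 1) * u) - sin (2 * j * u)\<close>, so the sum telescopes. It is the
  derivative of the partial sum of the square wave series.\<close>

lemma sum_cos_odd: "2 * sin u * (\<Sum>j<N. cos ((2 * real j + 1) * u)) = sin (2 * real N * u)"
proof (induction N)
  case (Suc N)
  have "2 * sin u * cos ((2 * real N + 1) * u) = sin (2 * real (Suc N) * u) - sin (2 * real N * u)"
  proof -
    have "2 * real (Suc N) * u = (2 * real N + 1) * u + u" "2 * real N * u = (2 * real N + 1) * u - u"
      by (simp_all add: algebra_simps)
    then show ?thesis
      by (simp only: sin_add sin_diff) (simp add: algebra_simps)
  qed
  with Suc show ?case
    by (simp add: distrib_left)
qed simp

text \<open>Adding \<open>cos (2Nu) / (4N sin u)\<close> to the partial sum turns its derivative, which oscillates with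
  amplitude of order 1, into one of order \<open>1/N\<close>.\<close>

lemma sum_sin_odd_diff_le:
  fixes d u :: real
  assumes d: "0 < d" "d \<le> pi / 2" and u: "u \<in> {d..pi - d}" and N: "N > 0"
  defines "S \<equiv> \<lambda>u. \<Sum>j<N. sin ((2 * real j + 1) * u) / (2 * real j + 1)"
  shows "\<bar>S u - S (pi / 2)\<bar> \<le> (pi / (sin d)\<^sup>2 + 2 / sin d) / (4 * real N)"
proof -
  have sd: "sin d > 0"
    using d pi_gt_zero by (intro sin_gt_zero) linarith+
  have sin_ge: "sin d \<le> sin v" if "v \<in> {d..pi - d}" for v
  proof (cases "v \<le> pi / 2")
    case True
    then show ?thesis
      using that d by (subst sin_mono_le_eq) auto
  next
    case False
    have "sin d \<le> sin (pi - v)"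
      using that d False by (subst sin_mono_le_eq) auto
    then show ?thesis by simp
  qed
  define R where "R v = cos (2 * real N * v) / (4 * real N * sin v)" for v
  define D where "D v = - (cos (2 * real N * v) * cos v / (4 * real N * (sin v)\<^sup>2))" for v
  have deriv: "((\<lambda>v. S v + R v) has_field_derivative D v) (at v)" if "v \<in> {d..pi - d}" for v
  proof -
    have sv: "sin v > 0"
      using sin_ge[OF that] sd by linarith
    have "(S has_field_derivative (\<Sum>j<N. cos ((2 * real j + 1) * v))) (at v)"
      unfolding S_def by (auto intro!: derivative_eq_intros sum.cong simp: add_nonneg_eq_0_iff)
    moreover have "(\<Sum>j<N. cos ((2 * real j + 1) * v)) = sin (2 * real N * v) / (2 * sin v)"
      using sum_cos_odd[of v N] sv by (simp add: field_simps)
    moreover have "(R has_field_derivative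
        (- sin (2 * real N * v) * (2 * real N) * (4 * real N * sin v) - cos (2 * real N * v) * (4 * real N * cos v))
        / ((4 * real N * sin v) * (4 * real N * sin v))) (at v)"
      unfolding R_def using sv N by (auto intro!: derivative_eq_intros)
    ultimately have "((\<lambda>v. S v + R v) has_field_derivative sin (2 * real N * v) / (2 * sin v) +
        (- sin (2 * real N * v) * (2 * real N) * (4 * real N * sin v) - cos (2 * real N * v) * (4 * real N * cos v))
        / ((4 * real N * sin v) * (4 * real N * sin v))) (at v)"
      by (auto intro!: DERIV_add)
    also have "sin (2 * real N * v) / (2 * sin v) +
        (- sin (2 * real N * v) * (2 * real N) * (4 * real N * sin v) - cos (2 * real N * v) * (4 * real N * cos v))
        / ((4 * real N * sin v) * (4 * real N * sin v)) = D v"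
      unfolding D_def using sv N by (simp add: field_simps power2_eq_square)
    finally show ?thesis .
  qed
  have D_le: "norm (D v) \<le> 1 / (4 * real N * (sin d)\<^sup>2)" if "v \<in> {d..pi - d}" for v
  proof -
    have "\<bar>cos (2 * real N * v) * cos v\<bar> \<le> 1 * 1"
      unfolding abs_mult by (intro mult_mono) auto
    moreover have "(sin d)\<^sup>2 \<le> (sin v)\<^sup>2"
      using sin_ge[OF that] sd by (intro power_mono) auto
    ultimately have "\<bar>cos (2 * real N * v) * cos v\<bar> / (4 * real N * (sin v)\<^sup>2) \<le> 1 / (4 * real N * (sin d)\<^sup>2)"
      using sd N by (intro frac_le mult_left_mono) auto
    then show ?thesis by (simp add: D_def abs_mult)
  qed
  have R_le: "\<bar>R v\<bar> \<le> 1 / (4 * real N * sin d)" if "v \<in> {d..pi - d}" for v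
  proof -
    have "\<bar>cos (2 * real N * v)\<bar> / (4 * real N * sin v) \<le> 1 / (4 * real N * sin d)"
      using sd N sin_ge[OF that] by (intro frac_le mult_left_mono) auto
    then show ?thesis using sd sin_ge[OF that] by (simp add: R_def abs_mult)
  qed
  \<comment> \<open>The base point of the comparison: at \<open>pi / 2\<close> the partial sums are
    those of the Leibniz series.\<close>
  have mid: "pi / 2 \<in> {d..pi - d}"
    using d by auto
  have "norm ((S u + R u) - (S (pi/2) + R (pi/2))) \<le> 1 / (4 * real N * (sin d)\<^sup>2) * norm (u - pi/2)"
  proof (rule field_differentiable_bound)
    show "convex {d..pi - d}" by simp
    show "((\<lambda>v. S v + R v) has_field_derivative D v) (at v within {d..pi - d})"
      if "v \<in> {d..pi - d}" for v
      using deriv[OF that] by (rule has_field_derivative_at_within)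
  qed (use D_le u mid in auto)
  also have "\<dots> \<le> 1 / (4 * real N * (sin d)\<^sup>2) * pi"
    using u d by (intro mult_left_mono) auto
  finally have "\<bar>S u - S (pi / 2)\<bar> \<le>
      1 / (4 * real N * (sin d)\<^sup>2) * pi + 1 / (4 * real N * sin d) + 1 / (4 * real N * sin d)"
    using R_le[OF u] R_le[OF mid] unfolding real_norm_def by linarith
  also have "\<dots> = (pi / (sin d)\<^sup>2 + 2 / sin d) / (4 * real N)"
    using sd N by (simp add: field_simps)
  finally show ?thesis .
qed

text \<open>At \<open>pi / 2\<close> this is the Leibniz series for \<open>pi / 4\<close>. Away from
  \<open>0\<close> and \<open>pi\<close> the partial sums differ from their value there by
  \<open>O(1/N)\<close> uniformly, so the limit is the same.\<close>

lemma uniform_limit_sin_odd: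
  fixes d :: real
  assumes d: "0 < d" "d \<le> pi / 2"
  shows "uniform_limit {d..pi - d} (\<lambda>N u. \<Sum>j<N. sin ((2 * real j + 1) * u) / (2 * real j + 1))
           (\<lambda>_. pi / 4) sequentially"
proof -
  define S where "S N u = (\<Sum>j<N. sin ((2 * real j + 1) * u) / (2 * real j + 1))" for N u
  define C where "C = pi / (sin d)\<^sup>2 + 2 / sin d"
  have sin_odd: "sin ((2 * real j + 1) * (pi / 2)) = (-1) ^ j" for j
  proof -
    have "(2 * real j + 1) * (pi / 2) = real j * pi + pi / 2"
      by (simp add: field_simps)
    then show ?thesis by (simp only: sin_add) simp
  qed
  have "summable (\<lambda>k. (-1)^k * 1 / real (k * 2 + 1))"
    using summable_arctan_series[of 1] by simp
  then have "(\<lambda>k. (-1)^k * 1 / real (k * 2 + 1)) sums (pi / 4)"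
    by (simp only: pi_series sums_iff)
  then have "(\<lambda>N. S N (pi / 2)) \<longlonglongrightarrow> pi / 4"
    unfolding S_def sin_odd sums_def by (simp add: mult.commute[of _ 2] add.commute)
  then have lim1: "(\<lambda>N. \<bar>S N (pi / 2) - pi / 4\<bar>) \<longlonglongrightarrow> 0"
    by (simp add: LIM_zero tendsto_rabs_zero)
  have lim2: "(\<lambda>N. C / (4 * real N)) \<longlonglongrightarrow> 0"
    by real_asymp
  have lim: "(\<lambda>N. C / (4 * real N) + \<bar>S N (pi / 2) - pi / 4\<bar>) \<longlonglongrightarrow> 0"
    using tendsto_add[OF lim2 lim1] by simp
  show ?thesis
    unfolding S_def[symmetric]
  proof (rule uniform_limitI)
    fix e :: real
    assume "e > 0"
    then have "eventually (\<lambda>N. C / (4 * real N) + \<bar>S N (pi / 2) - pi / 4\<bar> < e) sequentially"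
      using lim by (simp add: order_tendsto_iff)
    then show "eventually (\<lambda>N. \<forall>u\<in>{d..pi - d}. dist (S N u) (pi / 4) < e) sequentially"
      using eventually_gt_at_top[of 0]
    proof eventually_elim
      case (elim N)
      show ?case
      proof
        fix u assume "u \<in> {d..pi - d}"
        then have "\<bar>S N u - S N (pi / 2)\<bar> \<le> C / (4 * real N)"
          using sum_sin_odd_diff_le[OF d, of u N] elim by (simp add: S_def C_def)
        with elim show "dist (S N u) (pi / 4) < e"
          unfolding dist_real_def by linarith
      qed
    qed
  qed
qed

lemma inverse_odd_square_summable: "summable (\<lambda>j. 1 / (2 * real j + 1)\<^sup>2)"
proof (rule summable_comparison_test)
  show "\<exists>N. \<forall>j\<ge>N. norm (1 / (2 * real j + 1)\<^sup>2) \<le> 1 / (real (Suc j))\<^sup>2"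
    by (auto intro!: exI[of _ 0] frac_le power_mono)
  show "summable (\<lambda>j. 1 / (real (Suc j))\<^sup>2)"
    using inverse_squares_sums by (simp add: sums_iff)
qed

text \<open>Termwise, the derivative is minus the square wave series, hence \<open>- pi / 4\<close>
  inside the interval. So the sum is linear in \<open>t\<close>, up to the endpoints by
  continuity.\<close>

lemma triangle_wave_sums:
  assumes "t \<in> {0..pi}"
  shows "(\<lambda>j. cos ((2 * real j + 1) * t) / (2 * real j + 1)\<^sup>2) sums (pi\<^sup>2 / 8 - pi * t / 4)"
proof -
  define f where "f j t = cos ((2 * real j + 1) * t) / (2 * real j + 1)\<^sup>2" for j t
  have f_le: "norm (f j t) \<le> 1 / (2 * real j + 1)\<^sup>2" for j t
    unfolding f_def by (simp add: divide_right_mono)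
  have summ: "summable (\<lambda>j. f j t)" for t
    using f_le inverse_odd_square_summable by (rule summable_comparison_test'[rotated])
  have cont: "continuous_on {0..pi} (\<lambda>t. \<Sum>j. f j t)"
  proof (rule uniform_limit_theorem)
    show "uniform_limit {0..pi} (\<lambda>n t. \<Sum>j<n. f j t) (\<lambda>t. \<Sum>j. f j t) sequentially"
      by (rule Weierstrass_m_test[OF f_le inverse_odd_square_summable])
    show "\<forall>\<^sub>F n in sequentially. continuous_on {0..pi} (\<lambda>t. \<Sum>j<n. f j t)"
      unfolding f_def by (intro always_eventually allI continuous_intros) (auto simp: add_nonneg_eq_0_iff)
  qed simp
  have deriv: "((\<lambda>t. \<Sum>j. f j t) has_field_derivative - (pi / 4)) (at t)" if t: "0 < t" "t < pi" for t
  proof -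
    \<comment> \<open>Half the distance to the nearer endpoint, so that \<open>t\<close> is interior
      to \<open>{d..pi - d}\<close>.\<close>
    define d where "d = min t (pi - t) / 2"
    have d: "0 < d" "d \<le> pi / 2" and td: "t \<in> {d<..<pi - d}"
      using t by (auto simp: d_def min_def field_simps)
    have int: "t \<in> interior {d..pi - d}"
      using td by (simp add: interior_atLeastAtMost_real)
    have unif: "uniform_limit {d..pi - d} (\<lambda>N u. \<Sum>j<N. - (sin ((2 * real j + 1) * u) / (2 * real j + 1)))
           (\<lambda>_. - (pi / 4)) sequentially"
      using uniform_limit_uminus[OF uniform_limit_sin_odd[OF d]] by (simp add: sum_negf)
    have fd: "(f j has_field_derivative - (sin ((2 * real j + 1) * u) / (2 * real j + 1))) (at u within A)" for j u A
      unfolding f_def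
      by (auto intro!: derivative_eq_intros simp: add_nonneg_eq_0_iff power2_eq_square)
    \<comment> \<open>Termwise differentiation yields some limit \<open>g\<close> on
      \<open>{d..pi - d}\<close>; it agrees with the \<open>suminf\<close> near \<open>t\<close>,
      which transfers the derivative.\<close>
    have "\<exists>g. \<forall>u\<in>{d..pi - d}. (\<lambda>j. f j u) sums g u \<and>
        (g has_field_derivative - (pi / 4)) (at u within {d..pi - d})"
      by (rule has_field_derivative_series[OF _ fd unif, of t]) (use td summ in auto)
    then obtain g where g: "\<And>u. u \<in> {d..pi - d} \<Longrightarrow> (\<lambda>j. f j u) sums g u"
        "\<And>u. u \<in> {d..pi - d} \<Longrightarrow> (g has_field_derivative - (pi / 4)) (at u within {d..pi - d})"
      by blast
    have "(g has_field_derivative - (pi / 4)) (at t)"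
      using g(2)[of t] td unfolding at_within_interior[OF int] by auto
    also have "?this \<longleftrightarrow> ?thesis"
      using eventually_nhds_in_nhd[OF int] g(1)
      by (intro DERIV_cong_ev) (auto elim!: eventually_mono simp: sums_iff)
    finally show ?thesis .
  qed
  define g where "g t = (\<Sum>j. f j t) + pi * t / 4" for t
  have const: "g t = g 0" if "0 \<le> t" "t \<le> pi" for t
  proof (rule DERIV_isconst2[of 0 pi])
    show "continuous_on {0..pi} g"
      unfolding g_def by (intro continuous_intros cont) simp
    show "(g has_real_derivative 0) (at x)" if "0 < x" "x < pi" for x
      unfolding g_def by (auto intro!: derivative_eq_intros deriv that)
  qed (use that in auto)
  \<comment> \<open>All terms vanish at \<open>pi / 2\<close>, which fixes the constant.\<close>
  have "f j (pi / 2) = 0" for j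
  proof -
    have "(2 * real j + 1) * (pi / 2) = real j * pi + pi / 2"
      by (simp add: field_simps)
    then show ?thesis unfolding f_def by (simp only: cos_add) simp
  qed
  then have "g (pi / 2) = pi\<^sup>2 / 8"
    by (simp add: g_def power2_eq_square)
  then have "g t = pi\<^sup>2 / 8"
    using const[of t] const[of "pi / 2"] assms by simp
  then have "(\<Sum>j. f j t) = pi\<^sup>2 / 8 - pi * t / 4"
    by (simp add: g_def)
  with summ[of t] show ?thesis
    by (simp add: f_def sums_iff)
qed

section \<open>The frequencies and series with their powers as denominators\<close>

text \<open>\<^const>\<open>int_decode\<close> enumerates the integers, so that all series are indexed by \<^typ>\<open>nat\<close>;
  \<open>\<bar>freq j\<bar>\<close> then runs through the odd multiples of \<open>\<pi> / 2\<close> in increasing order.\<close>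

definition freq :: "nat \<Rightarrow> real" where
  "freq j = (4 * real_of_int (int_decode j) + 1) * (pi / 2)"

text \<open>\<open>int_decode\<close> sends \<open>2 * m\<close> to \<open>m\<close> and
  \<open>2 * m + 1\<close> to \<open>- m - 1\<close>; the numbers \<open>4 * m + 1\<close> and
  \<open>- (4 * m + 3)\<close> that result have absolute value \<open>2 * j + 1\<close>.\<close>

lemma abs_freq: "\<bar>freq j\<bar> = (2 * real j + 1) * (pi / 2)"
proof -
  have "\<bar>4 * int_decode j + 1\<bar> = 2 * int j + 1"
    by (cases "even j") (auto simp: int_decode_def sum_decode_def elim!: evenE oddE)
  then have "\<bar>real_of_int (4 * int_decode j + 1)\<bar> = real_of_int (2 * int j + 1)"
    by (simp only: flip: of_int_abs)
  then show ?thesis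
    by (simp add: freq_def abs_mult)
qed

lemma Suc_le_abs_freq: "real (Suc j) \<le> \<bar>freq j\<bar>"
proof -
  have "real (Suc j) \<le> (2 * real j + 1) * 1" by simp
  also have "\<dots> \<le> (2 * real j + 1) * (pi / 2)"
    using pi_ge_two by (intro mult_left_mono) auto
  finally show ?thesis
    by (simp only: abs_freq)
qed

lemma freq_nonzero [simp]: "freq j \<noteq> 0"
  using Suc_le_abs_freq[of j] by auto

text \<open>Each frequency is \<open>pi / 2\<close> modulo \<open>2 * pi\<close>. The signs of the
  numbers \<open>4 * k + 1\<close> matter here: for the absolute values the sine would
  alternate.\<close>

lemma sin_freq [simp]: "sin (freq j) = 1" and cos_freq [simp]: "cos (freq j) = 0"
proof -
  have "freq j = 2 * pi * real_of_int (int_decode j) + pi / 2"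
    by (simp add: freq_def field_simps)
  then show "sin (freq j) = 1" "cos (freq j) = 0"
    by (simp_all only: sin_add cos_add sin_int_2pin cos_int_2pin) simp_all
qed

text \<open>One majorant for all exponents: \<open>\<bar>freq j\<bar> \<ge> j + 1 \<ge> 1\<close>,
  so the exponent can be lowered to 2. The numerator \<open>c\<close> stands for a bounded
  trigonometric factor.\<close>

lemma norm_divide_freq_power_le:
  assumes "n \<ge> 2" "\<bar>c\<bar> \<le> B"
  shows "norm (c / freq j ^ n) \<le> B * (1 / (real (Suc j))\<^sup>2)"
proof -
  have "(real (Suc j))\<^sup>2 \<le> real (Suc j) ^ n"
    using assms(1) by (intro power_increasing) auto
  also have "\<dots> \<le> \<bar>freq j\<bar> ^ n"
    using Suc_le_abs_freq by (intro power_mono) auto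
  finally have "\<bar>c\<bar> / \<bar>freq j\<bar> ^ n \<le> B / (real (Suc j))\<^sup>2"
    using assms(2) by (intro frac_le) auto
  then show ?thesis
    by (simp add: power_abs)
qed

lemma summable_bound_freq: "summable (\<lambda>j. B * (1 / (real (Suc j))\<^sup>2))"
  using inverse_squares_sums by (intro summable_mult) (simp add: sums_iff)

lemma summable_divide_freq_power:
  assumes "n \<ge> 2" "\<And>j. \<bar>c j\<bar> \<le> B"
  shows "summable (\<lambda>j. norm (c j / freq j ^ n))" "summable (\<lambda>j. c j / freq j ^ n)"
proof -
  show "summable (\<lambda>j. norm (c j / freq j ^ n))"
    using norm_divide_freq_power_le[OF assms(1,2)] summable_bound_freq[of B]
    by (intro summable_comparison_test[of "\<lambda>j. norm (c j / freq j ^ n)"]) auto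
  then show "summable (\<lambda>j. c j / freq j ^ n)"
    by (rule summable_norm_cancel)
qed

text \<open>The differentiated series still has exponent at least 2, so it converges uniformly on
  the real line by the M-test.\<close>

lemma sin_freq_series_deriv:
  assumes n: "n \<ge> 2" and c: "\<And>j. \<bar>c j\<bar> \<le> B"
  shows "((\<lambda>y. \<Sum>j. c j * sin (freq j * y) / freq j ^ Suc n) has_field_derivative
           (\<Sum>j. c j * cos (freq j * y) / freq j ^ n)) (at y)"
proof (rule has_field_derivative_series'(2)[of UNIV])
  show "((\<lambda>y. c j * sin (freq j * y) / freq j ^ Suc n) has_field_derivative
      c j * cos (freq j * y) / freq j ^ n) (at y)" for j y
    by (auto intro!: derivative_eq_intros)
  have "\<bar>c j * cos (freq j * y)\<bar> \<le> B" for j y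
    using mult_mono[OF c[of j] abs_cos_le_one[of "freq j * y"]] c[of j] by (simp add: abs_mult)
  then show "uniformly_convergent_on UNIV (\<lambda>N y. \<Sum>j<N. c j * cos (freq j * y) / freq j ^ n)"
    using n by (intro Weierstrass_m_test'[OF _ summable_bound_freq[of B]] norm_divide_freq_power_le)
  \<comment> \<open>Convergence of the original series is required at one point; at \<open>0\<close>
    all its terms vanish.\<close>
  show "summable (\<lambda>j. c j * sin (freq j * 0) / freq j ^ Suc n)"
    by simp
qed auto

text \<open>Cosine is even, so only \<open>\<bar>freq j\<bar>\<close> matters and the series is the
  triangle wave at \<open>pi * \<bar>t\<bar> / 2\<close>, which lies in \<open>[0, pi]\<close> for
  \<open>\<bar>t\<bar> \<le> 2\<close>.\<close>

lemma cos_freq_sums: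
  assumes "\<bar>t\<bar> \<le> 2"
  shows "(\<lambda>j. cos (freq j * t) / (freq j)\<^sup>2) sums ((1 - \<bar>t\<bar>) / 2)"
proof -
  have eq: "cos (freq j * t) / (freq j)\<^sup>2 =
      4 / pi\<^sup>2 * (cos ((2 * real j + 1) * (pi * \<bar>t\<bar> / 2)) / (2 * real j + 1)\<^sup>2)" for j
  proof -
    have "cos (freq j * t) = cos \<bar>freq j * t\<bar>" by simp
    also have "\<bar>freq j * t\<bar> = (2 * real j + 1) * (pi * \<bar>t\<bar> / 2)"
      by (simp add: abs_mult abs_freq)
    finally have "cos (freq j * t) = cos ((2 * real j + 1) * (pi * \<bar>t\<bar> / 2))" .
    moreover have "(freq j)\<^sup>2 = pi\<^sup>2 / 4 * (2 * real j + 1)\<^sup>2"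
      using arg_cong[OF abs_freq, of "\<lambda>x. x\<^sup>2"] by (simp add: power_mult_distrib power_divide)
    ultimately show ?thesis
      by (simp only:) simp
  qed
  have "(\<lambda>j. 4 / pi\<^sup>2 * (cos ((2 * real j + 1) * (pi * \<bar>t\<bar> / 2)) / (2 * real j + 1)\<^sup>2)) sums
      (4 / pi\<^sup>2 * (pi\<^sup>2 / 8 - pi * (pi * \<bar>t\<bar> / 2) / 4))"
    using assms by (intro sums_mult triangle_wave_sums) auto
  moreover have "4 / pi\<^sup>2 * (pi\<^sup>2 / 8 - pi * (pi * \<bar>t\<bar> / 2) / 4) = (1 - \<bar>t\<bar>) / 2"
    by (simp add: field_simps power2_eq_square)
  ultimately show ?thesis
    by (simp only: eq)
qed

section \<open>Eigenfunction expansion of the iterated kernels\<close>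

text \<open>For \<open>n \<ge> 2\<close> and arguments in \<open>[0, 1]\<close> this is the kernel
  of \<open>T^n\<close>: the volume of the positions of the inner vertices of a path with
  \<open>n\<close> edges and ends at \<open>x\<close>, \<open>y\<close>. The factor 2 normalises the
  cosines, whose squares have integral \<open>1 / 2\<close> over \<open>[0, 1]\<close>.\<close>

definition path_kernel :: "nat \<Rightarrow> real \<Rightarrow> real \<Rightarrow> real" where
  "path_kernel n x y = (\<Sum>j. 2 * cos (freq j * x) * cos (freq j * y) / freq j ^ n)"

text \<open>The product of cosines splits into triangle waves at \<open>x - y\<close> and
  \<open>x + y\<close>, and
  \<open>(\<bar>x - y\<bar> + \<bar>x + y\<bar>) / 2 = max x y\<close>.\<close>

lemma path_kernel_2:
  assumes "x \<in> {0..1}" "y \<in> {0..1}"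
  shows "path_kernel 2 x y = 1 - max x y"
proof -
  have "(\<lambda>j. cos (freq j * (x - y)) / (freq j)\<^sup>2 + cos (freq j * (x + y)) / (freq j)\<^sup>2) sums
      ((1 - \<bar>x - y\<bar>) / 2 + (1 - \<bar>x + y\<bar>) / 2)"
    using assms by (intro sums_add cos_freq_sums) auto
  moreover have "cos (freq j * (x - y)) / (freq j)\<^sup>2 + cos (freq j * (x + y)) / (freq j)\<^sup>2 =
      2 * cos (freq j * x) * cos (freq j * y) / (freq j)\<^sup>2" for j
    by (simp add: cos_add cos_diff field_simps)
  moreover have "(1 - \<bar>x - y\<bar>) / 2 + (1 - \<bar>x + y\<bar>) / 2 = 1 - max x y"
    using assms by (auto simp: max_def field_simps)
  ultimately show ?thesis
    by (simp add: path_kernel_def sums_iff)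
qed

lemma measurable_path_kernel [measurable]: "path_kernel n x \<in> borel_measurable borel"
  unfolding path_kernel_def[abs_def] by measurable

text \<open>Integration over \<open>[0, 1 - y]\<close> has \<open>cos (freq j * y)\<close> as an eigenfunction with eigenvalue
  \<open>1 / freq j\<close>, because \<open>sin (freq j * (1 - y)) = cos (freq j * y)\<close>.\<close>

lemma nn_integral_path_kernel:
  assumes n: "n \<ge> 2" and y: "y \<in> {0..1}"
    and nonneg: "\<And>z. z \<in> {0..1} \<Longrightarrow> 0 \<le> path_kernel n x z"
  shows "(\<integral>\<^sup>+z. ennreal (path_kernel n x z) * indicator {0..1 - y} z \<partial>lborel) =
           ennreal (path_kernel (Suc n) x y)"
    and "0 \<le> path_kernel (Suc n) x y"
proof -
  define F where "F z = (\<Sum>j. 2 * cos (freq j * x) * sin (freq j * z) / freq j ^ Suc n)" for z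
  have deriv: "(F has_field_derivative path_kernel n x z) (at z)" for z
    unfolding F_def path_kernel_def
    by (rule sin_freq_series_deriv[OF n, where B = 2]) (simp add: abs_mult)
  have "(\<integral>\<^sup>+z. ennreal (path_kernel n x z) * indicator {0..1 - y} z \<partial>lborel) = F (1 - y) - F 0"
    using y by (intro nn_integral_FTC_Icc deriv nonneg) auto
  moreover have "sin (freq j * (1 - y)) = cos (freq j * y)" for j
    by (simp add: right_diff_distrib sin_diff)
  then have F1: "F (1 - y) = path_kernel (Suc n) x y"
    by (simp add: F_def path_kernel_def)
  have F0: "F 0 = 0"
    by (simp add: F_def)
  ultimately show "(\<integral>\<^sup>+z. ennreal (path_kernel n x z) * indicator {0..1 - y} z \<partial>lborel) =
           ennreal (path_kernel (Suc n) x y)"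
    using F1 F0 by simp
  \<comment> \<open>\<open>ennreal\<close> sends negative reals to 0, so nonnegativity has to be
    passed on to the next kernel; here it follows because \<open>F\<close> has a nonnegative
    derivative.\<close>
  have "F 0 \<le> F (1 - y)"
  proof (rule DERIV_nonneg_imp_nondecreasing[where f = F])
    show "\<exists>d. (F has_real_derivative d) (at z) \<and> 0 \<le> d" if "0 \<le> z" "z \<le> 1 - y" for z
      using deriv nonneg[of z] that y by auto
  qed (use y in auto)
  then show "0 \<le> path_kernel (Suc n) x y"
    using F1 F0 by simp
qed

text \<open>The trace as the sum of the eigenvalues. On the diagonal \<open>2 * cos^2\<close> is 1
  plus a cosine of the doubled argument, and the latter integrates to a multiple of
  \<open>sin (2 * freq j) = 0\<close>.\<close>

lemma nn_integral_path_kernel_diag: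
  assumes n: "n \<ge> 2" and nonneg: "\<And>x. x \<in> {0..1} \<Longrightarrow> 0 \<le> path_kernel n x x"
  shows "(\<integral>\<^sup>+x. ennreal (path_kernel n x x) * indicator {0..1} x \<partial>lborel) = ennreal (\<Sum>j. 1 / freq j ^ n)"
    and "0 \<le> (\<Sum>j. 1 / freq j ^ n)"
proof -
  define Z where "Z = (\<Sum>j. 1 / freq j ^ n)"
  define G where "G z = (\<Sum>j. 1 * sin (freq j * z) / freq j ^ Suc n)" for z
  \<comment> \<open>An antiderivative of the diagonal: \<open>Z * z\<close> for the constant part,
    \<open>G (2 * z) / 2\<close> for the doubled cosines.\<close>
  define F where "F z = Z * z + G (2 * z) / 2" for z
  have G: "(G has_field_derivative (\<Sum>j. 1 * cos (freq j * z) / freq j ^ n)) (at z)" for z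
    unfolding G_def by (rule sin_freq_series_deriv[OF n, where B = 1]) simp
  have diag: "path_kernel n x x = Z + (\<Sum>j. 1 * cos (freq j * (2 * x)) / freq j ^ n)" for x
  proof -
    have "2 * cos (freq j * x) * cos (freq j * x) / freq j ^ n =
        1 / freq j ^ n + 1 * cos (freq j * (2 * x)) / freq j ^ n" for j
      using cos_double_cos[of "freq j * x"]
      by (simp add: mult.left_commute power2_eq_square add_divide_distrib [symmetric] mult.assoc)
    then show ?thesis
      unfolding path_kernel_def Z_def
      by (subst suminf_add) (auto intro!: summable_divide_freq_power[OF n, where B = 1])
  qed
  have deriv: "(F has_field_derivative path_kernel n z z) (at z)" for z
    unfolding F_def diag
    by (auto intro!: derivative_eq_intros DERIV_chain2[OF G])
  have "sin (freq j * 2) = 0" for j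
    using sin_double[of "freq j"] by (simp add: mult.commute)
  then have F: "F 1 = Z" "F 0 = 0"
    by (simp_all add: F_def G_def)
  have "(\<integral>\<^sup>+x. ennreal (path_kernel n x x) * indicator {0..1} x \<partial>lborel) = F 1 - F 0"
  proof (rule nn_integral_FTC_Icc)
    show "(\<lambda>x. path_kernel n x x) \<in> borel_measurable borel"
      unfolding path_kernel_def by measurable
  qed (use deriv nonneg in auto)
  then show "(\<integral>\<^sup>+x. ennreal (path_kernel n x x) * indicator {0..1} x \<partial>lborel) = ennreal (\<Sum>j. 1 / freq j ^ n)"
    using F by (simp add: Z_def)
  have "F 0 \<le> F 1"
    by (rule DERIV_nonneg_imp_nondecreasing) (use deriv nonneg in auto)
  then show "0 \<le> (\<Sum>j. 1 / freq j ^ n)"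
    using F by (simp add: Z_def)
qed

section \<open>Integration over the path polytope, one vertex at a time\<close>

text \<open>The operator \<open>T\<close> acting on the second argument of a kernel: the former end
  \<open>z\<close> becomes an inner vertex and is integrated out, and \<open>y\<close> is the new
  end. Values in \<open>ennreal\<close> avoid integrability conditions.\<close>

definition attach_vertex :: "(real \<Rightarrow> real \<Rightarrow> ennreal) \<Rightarrow> real \<Rightarrow> real \<Rightarrow> ennreal" where
  "attach_vertex h x y = (\<integral>\<^sup>+z. h x z * indicator {0..1 - y} z \<partial>lborel)"

text \<open>On the unit square, the kernel of \<open>T\<close> itself. It is kept apart from the
  series, which need not converge absolutely at exponent 1.\<close>

definition edge_indicator :: "real \<Rightarrow> real \<Rightarrow> ennreal" where
  "edge_indicator x y = indicator {..1} (x + y)"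

text \<open>Starting from one edge, \<open>Suc k\<close> attachments give a path with
  \<open>k + 2\<close> edges. The first gives \<open>1 - max x y\<close>, where the expansion
  starts; each further one raises the exponent by 1.\<close>

lemma attach_vertex_power_edge_indicator:
  assumes "x \<in> {0..1}" "y \<in> {0..1}"
  shows "(attach_vertex ^^ Suc k) edge_indicator x y = ennreal (path_kernel (k + 2) x y) \<and>
         0 \<le> path_kernel (k + 2) x y"
  using assms(2)
proof (induction k arbitrary: y)
  case 0
  \<comment> \<open>The constraints \<open>z \<le> 1 - x\<close> and \<open>z \<le> 1 - y\<close>
    merge.\<close>
  have "attach_vertex edge_indicator x y = (\<integral>\<^sup>+z. indicator {0..1 - max x y} z \<partial>lborel)"
    unfolding attach_vertex_def edge_indicator_def
    by (intro nn_integral_cong) (auto split: split_indicator)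
  also have "\<dots> = ennreal (1 - max x y)"
    using assms 0 by simp
  finally show ?case
    using path_kernel_2[OF assms(1) 0] assms(1) 0 by (simp add: numeral_2_eq_2)
next
  case (Suc k)
  have "(attach_vertex ^^ Suc (Suc k)) edge_indicator x y =
      (\<integral>\<^sup>+z. (attach_vertex ^^ Suc k) edge_indicator x z * indicator {0..1 - y} z \<partial>lborel)"
    by (simp add: attach_vertex_def)
  also have "\<dots> = (\<integral>\<^sup>+z. ennreal (path_kernel (k + 2) x z) * indicator {0..1 - y} z \<partial>lborel)"
    using Suc.IH Suc.prems by (intro nn_integral_cong) (auto split: split_indicator)
  finally show ?case
    using nn_integral_path_kernel[of "k + 2" y x] Suc.IH Suc.prems by simp
qed

lemma measurable_attach_vertex [measurable]:
  assumes [measurable]: "(\<lambda>(x, y). h x y) \<in> borel_measurable (borel \<Otimes>\<^sub>M borel)"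
  shows "(\<lambda>(x, y). attach_vertex h x y) \<in> borel_measurable (borel \<Otimes>\<^sub>M borel)"
proof -
  have [measurable]: "(\<lambda>p. h (fst (fst p)) (snd p)) \<in> borel_measurable ((borel \<Otimes>\<^sub>M borel) \<Otimes>\<^sub>M borel)"
    using measurable_compose[OF _ assms, of "\<lambda>p. (fst (fst p), snd p)"] by simp
  \<comment> \<open>The interval of integration varies with \<open>snd p\<close>, so its indicator
    is written as a condition measurable jointly in \<open>p\<close> and \<open>z\<close>.\<close>
  have "(\<lambda>p. \<integral>\<^sup>+z. h (fst p) z * (if 0 \<le> z \<and> z \<le> 1 - snd p then 1 else 0) \<partial>lborel)
      \<in> borel_measurable (borel \<Otimes>\<^sub>M borel)"
    by measurable
  then show ?thesis
    by (simp add: attach_vertex_def case_prod_unfold indicator_def)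
qed

text \<open>Not restricted to extensional functions, so that membership ignores all coordinates
  outside \<open>{1..m}\<close>.\<close>

definition path_polytope :: "nat \<Rightarrow> (nat \<Rightarrow> real) set" where
  "path_polytope m = {x. (\<forall>i\<in>{1..m}. 0 \<le> x i \<and> x i \<le> 1) \<and> (\<forall>i\<in>{1..<m}. x i + x (Suc i) \<le> 1)}"

text \<open>The bound by 1 on the new coordinate follows from its edge constraint and
  \<open>0 \<le> x (Suc m)\<close>.\<close>

lemma path_polytope_Suc_Suc:
  "x \<in> path_polytope (Suc (Suc m)) \<longleftrightarrow>
    x \<in> path_polytope (Suc m) \<and> x (Suc (Suc m)) \<in> {0..1 - x (Suc m)}"
proof -
  have eqs: "{1..Suc (Suc m)} = insert (Suc (Suc m)) {1..Suc m}"
    "{1..<Suc (Suc m)} = insert (Suc m) {1..<Suc m}"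
    by auto
  have "0 \<le> x (Suc m)" if "\<forall>i\<in>{1..Suc m}. 0 \<le> x i \<and> x i \<le> 1"
    using that by simp
  then show ?thesis
    unfolding path_polytope_def mem_Collect_eq eqs ball_insert atLeastAtMost_iff by argo
qed

lemma path_polytope_fun_upd:
  "j > m \<Longrightarrow> x(j := y) \<in> path_polytope m \<longleftrightarrow> x \<in> path_polytope m"
  by (auto simp: path_polytope_def)

lemma measurable_indicator_path_polytope [measurable]:
  "indicator (path_polytope m) \<in> (borel_measurable (Pi\<^sub>M {1..m} (\<lambda>_. lborel)) :: (_ \<Rightarrow> ennreal) set)"
proof -
  let ?M = "Pi\<^sub>M {1..m} (\<lambda>_. lborel :: real measure)"
  have [measurable]: "(\<lambda>x. x i) \<in> borel_measurable ?M" if "i \<in> {1..m}" for i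
    using measurable_component_singleton[OF that, of "\<lambda>_. lborel"] by simp
  have "{x \<in> space ?M. \<forall>i\<in>{1..m}. 0 \<le> x i \<and> x i \<le> 1} \<in> sets ?M"
    by (intro sets.sets_Collect_finite_All sets.sets_Collect_conj) auto
  moreover have "{x \<in> space ?M. \<forall>i\<in>{1..<m}. x i + x (Suc i) \<le> 1} \<in> sets ?M"
  proof (rule sets.sets_Collect_finite_All)
    fix i assume "i \<in> {1..<m}"
    then have "i \<in> {1..m}" "Suc i \<in> {1..m}" by auto
    then show "{x \<in> space ?M. x i + x (Suc i) \<le> 1} \<in> sets ?M" by measurable
  qed simp
  ultimately have "{x \<in> space ?M. x \<in> path_polytope m} \<in> sets ?M"
    using sets.sets_Collect_conj by (simp add: path_polytope_def)
  moreover have "{x \<in> space ?M. x \<in> path_polytope m} = path_polytope m \<inter> space ?M" by blast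
  ultimately show ?thesis
    by (simp add: borel_measurable_indicator_iff)
qed

text \<open>Integrating out the last coordinate by Fubini replaces the weight \<open>h\<close>
  between the two ends by \<open>attach_vertex h\<close>; hence the induction over all
  \<open>h\<close>. With one vertex left both arguments of the weight coincide, which makes the
  result a trace.\<close>

lemma nn_integral_path_polytope:
  assumes "(\<lambda>(x, y). h x y) \<in> borel_measurable (borel \<Otimes>\<^sub>M borel)"
  shows "(\<integral>\<^sup>+x. h (x 1) (x (Suc m)) * indicator (path_polytope (Suc m)) x \<partial>Pi\<^sub>M {1..Suc m} (\<lambda>_. lborel)) =
    (\<integral>\<^sup>+x. (attach_vertex ^^ m) h x x * indicator {0..1} x \<partial>lborel)"
  using assms
proof (induction m arbitrary: h)
  case 0
  interpret product_sigma_finite "\<lambda>_::nat. lborel :: real measure" ..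
  have [measurable]: "(\<lambda>x. h x x) \<in> borel_measurable borel"
    using measurable_compose[OF _ 0, of "\<lambda>x. (x, x)"] by simp
  have "(\<integral>\<^sup>+x. h (x 1) (x 1) * indicator (path_polytope 1) x \<partial>Pi\<^sub>M {1::nat} (\<lambda>_. lborel)) =
      (\<integral>\<^sup>+x. (\<lambda>t. h t t * indicator {0..1} t) (x 1) \<partial>Pi\<^sub>M {1::nat} (\<lambda>_. lborel))"
    by (intro nn_integral_cong) (auto simp: path_polytope_def split: split_indicator)
  also have "\<dots> = (\<integral>\<^sup>+t. h t t * indicator {0..1} t \<partial>lborel)"
    by (intro product_nn_integral_singleton) measurable
  finally show ?case by simp
next
  case (Suc m)
  interpret product_sigma_finite "\<lambda>_::nat. lborel :: real measure" ..
  let ?I = "{1..Suc m}" and ?J = "{1..Suc (Suc m)}"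
  have J: "?J = insert (Suc (Suc m)) ?I" by auto
  have [measurable]: "(\<lambda>x. x i) \<in> borel_measurable (Pi\<^sub>M ?J (\<lambda>_. lborel))" if "i \<in> ?J" for i
    using measurable_component_singleton[OF that, of "\<lambda>_. lborel"] by simp
  have "(\<lambda>x. h (x 1) (x (Suc (Suc m)))) \<in> borel_measurable (Pi\<^sub>M ?J (\<lambda>_. lborel))"
    by (rule measurable_compose[OF _ Suc.prems, of "\<lambda>x. (x 1, x (Suc (Suc m)))", simplified prod.case]) measurable
  then have meas: "(\<lambda>x. h (x 1) (x (Suc (Suc m))) * indicator (path_polytope (Suc (Suc m))) x)
      \<in> borel_measurable (Pi\<^sub>M (insert (Suc (Suc m)) ?I) (\<lambda>_. lborel))"
    unfolding J[symmetric] by (rule borel_measurable_times_ennreal) (rule measurable_indicator_path_polytope)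
  have ind: "indicator (path_polytope (Suc (Suc m))) (x(Suc (Suc m) := y)) =
      indicator (path_polytope (Suc m)) x * (indicator {0..1 - x (Suc m)} y :: ennreal)" for x y
    by (auto simp: path_polytope_Suc_Suc path_polytope_fun_upd split: split_indicator)
  have "(\<integral>\<^sup>+x. h (x 1) (x (Suc (Suc m))) * indicator (path_polytope (Suc (Suc m))) x \<partial>Pi\<^sub>M ?J (\<lambda>_. lborel)) =
    (\<integral>\<^sup>+x. (\<integral>\<^sup>+y. h (x 1) y * (indicator (path_polytope (Suc m)) x * indicator {0..1 - x (Suc m)} y) \<partial>lborel)
      \<partial>Pi\<^sub>M ?I (\<lambda>_. lborel))"
    unfolding J by (subst product_nn_integral_insert[OF _ _ meas]) (auto simp: ind)
  also have "\<dots> = (\<integral>\<^sup>+x. attach_vertex h (x 1) (x (Suc m)) * indicator (path_polytope (Suc m)) x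
      \<partial>Pi\<^sub>M ?I (\<lambda>_. lborel))"
    unfolding attach_vertex_def by (intro nn_integral_cong) (auto split: split_indicator)
  also have "\<dots> = (\<integral>\<^sup>+x. (attach_vertex ^^ m) (attach_vertex h) x x * indicator {0..1} x \<partial>lborel)"
    using Suc.prems by (intro Suc.IH measurable_attach_vertex)
  \<comment> \<open>The induction attaches first and iterates afterwards, whereas \<open>^^\<close>
    unfolds on the outside.\<close>
  finally show ?case
    by (simp add: funpow_swap1)
qed

section \<open>The volume of the cycle polytope and the series\<close>

text \<open>The cycle is the path \<open>1, ..., n\<close> closed by the edge from \<open>n\<close>
  to \<open>1\<close>. With \<open>edge_indicator\<close> as weight between the ends, integrating
  out \<open>n - 1\<close> vertices leaves the trace of \<open>T^n\<close>.\<close>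

lemma graph_vol_cycle_graph:
  assumes "n \<ge> 2"
  shows "graph_vol (cycle_graph n) = (\<Sum>j. 1 / freq j ^ n)"
proof -
  define k where "k = n - 2"
  have k: "n = Suc (Suc k)"
    using assms by (simp add: k_def)
  let ?M = "Pi\<^sub>M {1..n} (\<lambda>_. lborel :: real measure)"
  interpret pair_graph "cycle_graph n"
    by (rule pair_graph_cycle_graph[OF assms])
  have verts: "pverts (cycle_graph n) = {1..n}"
    by (simp add: cycle_graph_def)
  have sets: "graph_polytope (cycle_graph n) \<in> sets ?M"
    using graph_polytope_measurable[OF pair_fin_digraph_axioms] unfolding verts .
  have edge: "(\<lambda>(x, y). edge_indicator x y) \<in> borel_measurable (borel \<Otimes>\<^sub>M borel)"
    unfolding edge_indicator_def case_prod_unfold by measurable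
  have nonneg: "0 \<le> path_kernel n x x" if "x \<in> {0..1}" for x
    using attach_vertex_power_edge_indicator[OF that that, of k] k by simp
  have "emeasure ?M (graph_polytope (cycle_graph n)) =
      (\<integral>\<^sup>+x. indicator (graph_polytope (cycle_graph n)) x \<partial>?M)"
    using sets by simp
  also have "\<dots> = (\<integral>\<^sup>+x. edge_indicator (x 1) (x n) * indicator (path_polytope n) x \<partial>?M)"
  proof (rule nn_integral_cong)
    fix x assume "x \<in> space ?M"
    then have "x \<in> extensional {1..n}"
      by (simp add: space_PiM PiE_def)
    then have "x \<in> graph_polytope (cycle_graph n) \<longleftrightarrow> (\<forall>i\<in>{1..n}. 0 \<le> x i \<and> x i \<le> 1) \<and>
        (\<forall>i\<in>{1..n}. x i + x (if i = n then 1 else i + 1) \<le> 1)"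
      unfolding graph_polytope_cycle_graph PiE_iff by simp
    moreover have "{1..n} = insert n {1..<n}"
      using assms by auto
    then have "(\<forall>i\<in>{1..n}. x i + x (if i = n then 1 else i + 1) \<le> 1) \<longleftrightarrow>
        x 1 + x n \<le> 1 \<and> (\<forall>i\<in>{1..<n}. x i + x (Suc i) \<le> 1)"
      by (simp only: ball_insert) (auto simp: add.commute)
    ultimately have "x \<in> graph_polytope (cycle_graph n) \<longleftrightarrow> x 1 + x n \<le> 1 \<and> x \<in> path_polytope n"
      unfolding path_polytope_def mem_Collect_eq by argo
    then show "indicator (graph_polytope (cycle_graph n)) x =
        edge_indicator (x 1) (x n) * indicator (path_polytope n) x"
      by (auto simp: edge_indicator_def split: split_indicator)
  qed
  also have "\<dots> = (\<integral>\<^sup>+x. (attach_vertex ^^ Suc k) edge_indicator x x * indicator {0..1} x \<partial>lborel)"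
    unfolding k using edge by (rule nn_integral_path_polytope)
  also have "\<dots> = (\<integral>\<^sup>+x. ennreal (path_kernel n x x) * indicator {0..1} x \<partial>lborel)"
    using attach_vertex_power_edge_indicator[of _ _ k] k
    by (intro nn_integral_cong) (auto split: split_indicator)
  also have "\<dots> = ennreal (\<Sum>j. 1 / freq j ^ n)"
    using assms nonneg by (rule nn_integral_path_kernel_diag)
  \<comment> \<open>\<open>measure\<close> is the real part of \<open>emeasure\<close>;
    nonnegativity of the sum cancels the \<open>ennreal\<close>.\<close>
  finally show ?thesis
    using nn_integral_path_kernel_diag(2)[OF assms nonneg]
    by (simp add: graph_vol_def measure_def verts)
qed

theorem theorem5p2:
  fixes n :: nat
  assumes "n \<ge> 2"
  shows "((\<lambda>k::int. 1 / (4 * real_of_int k + 1) ^ n) has_sum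
           (pi ^ n * graph_vol (cycle_graph n) / 2 ^ n)) UNIV"
proof -
  \<comment> \<open>The eigenvalue \<open>1 / freq j\<close> is
    \<open>2 / ((4 * k + 1) * pi)\<close> with \<open>k = int_decode j\<close>.\<close>
  have eq: "(pi / 2) ^ n * (1 / freq j ^ n) = 1 / (4 * real_of_int (int_decode j) + 1) ^ n" for j
    by (simp only: freq_def power_mult_distrib) simp
  \<comment> \<open>Absolute convergence makes the sum independent of the order, so it can be
    reindexed from the naturals to the integers.\<close>
  have "((\<lambda>j. 1 / freq j ^ n) has_sum (\<Sum>j. 1 / freq j ^ n)) UNIV"
    using assms
    by (intro norm_summable_imp_has_sum summable_sums summable_divide_freq_power[where B = 1]) simp_all
  then have "((\<lambda>j. (pi / 2) ^ n * (1 / freq j ^ n)) has_sum ((pi / 2) ^ n * graph_vol (cycle_graph n))) UNIV"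
    unfolding graph_vol_cycle_graph[OF assms] by (rule has_sum_cmult_right)
  then have "((\<lambda>k. 1 / (4 * real_of_int k + 1) ^ n) has_sum ((pi / 2) ^ n * graph_vol (cycle_graph n))) UNIV"
    unfolding eq has_sum_reindex_bij_betw[OF bij_int_decode, where f = "\<lambda>k. 1 / (4 * real_of_int k + 1) ^ n"] .
  then show ?thesis
    by (simp add: power_divide)
qed

end
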